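(* Let $\mathcal{T}$ be a tree of order $n$ with $m=n-1$ edges. Then \[ \frac{1}{\sqrt{2}}\Bigl(\sigma(\mathcal{T})+\frac{4m^2}{n}\Bigr)\le \mathrm{SO}(\mathcal{T})\le \sigma(\mathcal{T})+\frac{4m^2}{n}. \]
   Context: The Sombor index of a graph $G$ is $\mathrm{SO}(G)=\sum_{uv\in E(G)}\sqrt{d_G(u)^2+d_G(v)^2}$. In this result the Sigma index of a tree $\mathcal{T}$ with $n$ vertices and $m=n-1$ edges is $\sigma(\mathcal{T})=\sum_{v\in V(\mathcal{T})}\bigl(d_{\mathcal{T}}(v)-\tfrac{2(n-1)}{n}\bigr)^2=\sum_{v\in V(\mathcal{T})} d_{\mathcal{T}}(v)^2-\frac{4(n-1)^2}{n}$. *)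

theory Defs
  imports Complex_Main
begin

definition simple_graph :: "'a set \<Rightarrow> 'a set set \<Rightarrow> bool" where
  "simple_graph V E \<longleftrightarrow> finite V \<and> (\<forall>e\<in>E. e \<subseteq> V \<and> card e = 2)"

definition adjacent :: "'a set set \<Rightarrow> 'a \<Rightarrow> 'a \<Rightarrow> bool" where
  "adjacent E u v \<longleftrightarrow> {u, v} \<in> E"

definition connected_graph :: "'a set \<Rightarrow> 'a set set \<Rightarrow> bool" where
  "connected_graph V E \<longleftrightarrow> V \<noteq> {} \<and> (\<forall>u\<in>V. \<forall>v\<in>V. (adjacent E)\<^sup>*\<^sup>* u v)"

text \<open>A cycle is given by the list of its vertices, the first vertex not being repeated at the end.\<close>

definition is_cycle :: "'a set set \<Rightarrow> 'a list \<Rightarrow> bool" where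
  "is_cycle E xs \<longleftrightarrow> 3 \<le> length xs \<and> distinct xs \<and>
     successively (adjacent E) xs \<and> adjacent E (last xs) (hd xs)"

definition is_tree :: "'a set \<Rightarrow> 'a set set \<Rightarrow> bool" where
  "is_tree V E \<longleftrightarrow> simple_graph V E \<and> connected_graph V E \<and> (\<nexists>xs. is_cycle E xs)"

definition vdegree :: "'a set set \<Rightarrow> 'a \<Rightarrow> nat" where
  "vdegree E v = card {e \<in> E. v \<in> e}"

text \<open>Edges are two-element sets, so for \<open>e = {u, v}\<close> the inner sum is
  \<open>d(u)\<^sup>2 + d(v)\<^sup>2\<close>.\<close>

definition sombor_index :: "'a set set \<Rightarrow> real" where
  "sombor_index E = (\<Sum>e\<in>E. sqrt (\<Sum>v\<in>e. (real (vdegree E v))\<^sup>2))"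

text \<open>The subtracted term is the average degree of a tree on \<open>V\<close>.\<close>

definition sigma_index :: "'a set \<Rightarrow> 'a set set \<Rightarrow> real" where
  "sigma_index V E =
     (\<Sum>v\<in>V. (real (vdegree E v) - 2 * (real (card V) - 1) / real (card V))\<^sup>2)"

end

theory Submission
  imports Defs
begin

text \<open>Since a tree has \<open>m = n - 1\<close> edges, \<open>\<sigma> + 4m\<^sup>2/n\<close> is the sum of the squared degrees,
  which by double counting equals the sum of \<open>d(u) + d(v)\<close> over the edges \<open>uv\<close>. The bounds then
  hold edge by edge, from \<open>(a + b)/\<surd>2 \<le> \<surd>(a\<^sup>2 + b\<^sup>2) \<le> a + b\<close>.

  For \<open>m \<le> n - 1\<close>, the end of a longest path in an acyclic graph has degree at most one, and
  one deletes it and inducts. For \<open>m \<ge> n - 1\<close>, fix a root of the connected graph and send every other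
  vertex to an edge towards a vertex closer to the root; this map is injective.\<close>

lemma simple_graph_finite_edges: "simple_graph V E \<Longrightarrow> finite E"
  by (rule finite_subset[of _ "Pow V"]) (auto simp: simple_graph_def)

lemma simple_graph_other_end:
  assumes "simple_graph V E" "e \<in> E" "x \<in> e"
  obtains y where "e = {x, y}" "y \<noteq> x" "y \<in> V"
proof -
  have "card e = 2" "e \<subseteq> V"
    using assms by (auto simp: simple_graph_def)
  then obtain a b where "e = {a, b}" "a \<noteq> b"
    by (auto simp: card_2_iff)
  with that assms(3) \<open>e \<subseteq> V\<close> show thesis
    by (cases "x = a") (auto simp: insert_commute)
qed

text \<open>Passes acyclicity on to the graph that remains when a vertex is deleted.\<close>

lemma is_cycle_mono: "is_cycle E' xs \<Longrightarrow> E' \<subseteq> E \<Longrightarrow> is_cycle E xs"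
  by (auto simp: is_cycle_def adjacent_def intro: successively_mono)

text \<open>A second edge at the head of a longest path leads either off the path, making it longer,
  or back to it, closing a cycle.\<close>

lemma acyclic_low_degree:
  assumes graph: "simple_graph V E" and "V \<noteq> {}" and acyclic: "\<nexists>xs. is_cycle E xs"
  shows "\<exists>v\<in>V. vdegree E v \<le> 1"
proof -
  define P where "P xs \<longleftrightarrow> xs \<noteq> [] \<and> distinct xs \<and> set xs \<subseteq> V \<and> successively (adjacent E) xs" for xs
  obtain v where "v \<in> V"
    using \<open>V \<noteq> {}\<close> by blast
  have "finite V"
    using graph by (simp add: simple_graph_def)
  have "P [v]"
    using \<open>v \<in> V\<close> by (simp add: P_def)
  moreover have "\<forall>xs. P xs \<longrightarrow> length xs < Suc (card V)"
    using \<open>finite V\<close> by (auto simp: P_def less_Suc_eq_le distinct_card[symmetric] intro: card_mono)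
  ultimately obtain xs where xs: "P xs" and longest: "\<And>ys. P ys \<Longrightarrow> length ys \<le> length xs"
    using ex_has_greatest_nat[of P "[v]" length "Suc (card V)"] by auto
  from xs obtain x ys where xs_eq: "xs = x # ys"
    by (cases xs) (auto simp: P_def)
  have "vdegree E x \<le> 1"
  proof (rule ccontr)
    assume "\<not> vdegree E x \<le> 1"
    \<comment> \<open>\<open>{x, hd ys}\<close> is the path edge at \<open>x\<close>. If
      \<open>ys = []\<close>, then \<open>hd ys\<close> is arbitrary, which is harmless: here it
      only matters that the right-hand set has one element.\<close>
    then have "\<not> {e \<in> E. x \<in> e} \<subseteq> {{x, hd ys}}"
      using card_mono[of "{{x, hd ys}}" "{e \<in> E. x \<in> e}"] by (auto simp: vdegree_def)
    then obtain e where e: "e \<in> E" "x \<in> e" "e \<noteq> {x, hd ys}"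
      by blast
    obtain y where y: "e = {x, y}" "y \<noteq> x" "y \<in> V"
      using simple_graph_other_end[OF graph e(1,2)] .
    have adj: "adjacent E y x"
      using e(1) y(1) by (simp add: adjacent_def insert_commute)
    have "y \<in> set ys"
    proof (rule ccontr)
      assume "y \<notin> set ys"
      then have "P (y # xs)"
        using xs y adj by (auto simp: P_def xs_eq)
      then show False
        using longest by fastforce
    qed
    then obtain as bs where ys: "ys = as @ y # bs"
      by (auto simp: in_set_conv_decomp)
    \<comment> \<open>If \<open>as\<close> were empty, \<open>y\<close> would be
      \<open>hd ys\<close> and \<open>e\<close> the excluded edge. So the closed path has at least
      three vertices, as a cycle must.\<close>
    have "as \<noteq> []"
      using e(3) y(1) ys by auto
    then have "is_cycle E (x # as @ [y])"
      using xs adj unfolding is_cycle_def P_def xs_eq ys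
      by (cases as) (auto simp: successively_append_iff successively_Cons hd_append)
    then show False
      using acyclic by blast
  qed
  moreover have "x \<in> V"
    using xs by (simp add: P_def xs_eq)
  ultimately show ?thesis
    by blast
qed

lemma acyclic_card_edges:
  assumes "simple_graph V E" "V \<noteq> {}" "\<nexists>xs. is_cycle E xs"
  shows "Suc (card E) \<le> card V"
  using assms
proof (induction "card V" arbitrary: V E rule: less_induct)
  case less
  have fin: "finite V" "finite E"
    using less.prems(1) simple_graph_finite_edges by (auto simp: simple_graph_def)
  obtain v where v: "v \<in> V" "vdegree E v \<le> 1"
    using acyclic_low_degree less.prems by blast
  define E' where "E' = {e \<in> E. v \<notin> e}"
  have graph': "simple_graph (V - {v}) E'"
    using less.prems(1) by (auto simp: simple_graph_def E'_def)
  have "E = E' \<union> {e \<in> E. v \<in> e}"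
    by (auto simp: E'_def)
  then have "card E \<le> card E' + vdegree E v"
    unfolding vdegree_def by (metis card_Un_le)
  then have le: "card E \<le> Suc (card E')"
    using v(2) by linarith
  \<comment> \<open>A single vertex is treated apart, since the induction hypothesis asks for a
    nonempty vertex set after the deletion.\<close>
  show ?case
  proof (cases "V = {v}")
    case True
    have "e \<notin> E" for e
    proof
      assume "e \<in> E"
      then have "card e = 2" "e \<subseteq> {v}"
        using less.prems(1) True by (auto simp: simple_graph_def)
      then show False
        using card_mono[of "{v}" e] by simp
    qed
    then have "E = {}"
      by blast
    then show ?thesis
      using True by simp
  next
    case False
    have "card (V - {v}) < card V"
      using fin(1) v(1) by (rule card_Diff1_less)
    moreover have "\<nexists>xs. is_cycle E' xs"
      using less.prems(3) is_cycle_mono[of E' _ E] by (auto simp: E'_def)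
    ultimately have "Suc (card E') \<le> card (V - {v})"
      using less.hyps graph' False v(1) by blast
    then show ?thesis
      using le \<open>card (V - {v}) < card V\<close> by linarith
  qed
qed

lemma connected_card_edges:
  assumes graph: "simple_graph V E" and conn: "connected_graph V E"
  shows "card V \<le> Suc (card E)"
proof -
  obtain r where r: "r \<in> V"
    using conn by (auto simp: connected_graph_def)
  \<comment> \<open>\<open>h v\<close> is the distance from the root \<open>r\<close> to
    \<open>v\<close>.\<close>
  define h where "h v = (LEAST k. (adjacent E ^^ k) r v)" for v
  have walk: "(adjacent E ^^ h v) r v" if "v \<in> V" for v
  proof -
    have "\<exists>k. (adjacent E ^^ k) r v"
      using conn r that by (auto simp: connected_graph_def rtranclp_power)
    then show ?thesis
      unfolding h_def by (rule LeastI_ex)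
  qed
  \<comment> \<open>The neighbour \<open>u\<close> is the last vertex before \<open>v\<close> on a
    shortest walk from \<open>r\<close>; distance 0 would force \<open>v = r\<close>.\<close>
  have "\<exists>u. adjacent E u v \<and> h u < h v" if v: "v \<in> V - {r}" for v
  proof (cases "h v")
    case 0
    then show ?thesis
      using walk[of v] v by auto
  next
    case (Suc k)
    then obtain u where "(adjacent E ^^ k) r u" "adjacent E u v"
      using walk[of v] v by (metis DiffD1 relpowp_Suc_E)
    moreover from this(1) have "h u \<le> k"
      unfolding h_def by (rule Least_le)
    ultimately show ?thesis
      using Suc by auto
  qed
  then obtain p where p: "\<And>v. v \<in> V - {r} \<Longrightarrow> adjacent E (p v) v \<and> h (p v) < h v"
    by metis
  have "inj_on (\<lambda>v. {p v, v}) (V - {r})"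
  proof (rule inj_onI)
    fix v w
    assume vw: "v \<in> V - {r}" "w \<in> V - {r}" "{p v, v} = {p w, w}"
    have "h (p v) < h v" "h (p w) < h w"
      using p vw(1,2) by blast+
    \<comment> \<open>Two distinct vertices could share an edge only by being each other's parent,
      and then each would be strictly closer to \<open>r\<close> than the other.\<close>
    then have "\<not> (p v = w \<and> v = p w)"
      by (metis less_asym)
    then show "v = w"
      using vw(3) unfolding doubleton_eq_iff by blast
  qed
  moreover have "(\<lambda>v. {p v, v}) ` (V - {r}) \<subseteq> E"
    using p by (auto simp: adjacent_def)
  ultimately have "card (V - {r}) \<le> card E"
    using simple_graph_finite_edges[OF graph] by (rule card_inj_on_le)
  then show ?thesis
    using r by (simp add: card_Diff_singleton)
qed

lemma tree_card_vertices:
  assumes "is_tree V E"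
  shows "card V = Suc (card E)"
  using assms acyclic_card_edges[of V E] connected_card_edges[of V E]
  by (auto simp: is_tree_def connected_graph_def intro: le_antisym)

text \<open>Both sides count the incident pairs of a vertex \<open>v\<close> and an edge, each with
  weight \<open>f v\<close>. Weight 1 gives the handshake lemma, and the degree as weight gives the
  sum of squared degrees.\<close>

lemma sum_vdegree_mult:
  fixes f :: "'a \<Rightarrow> real"
  assumes "simple_graph V E"
  shows "(\<Sum>v\<in>V. real (vdegree E v) * f v) = (\<Sum>e\<in>E. \<Sum>v\<in>e. f v)"
proof -
  have fin: "finite V" "finite E"
    using assms simple_graph_finite_edges by (auto simp: simple_graph_def)
  have "(\<Sum>v\<in>V. real (vdegree E v) * f v) = (\<Sum>v\<in>V. \<Sum>e | e \<in> E \<and> v \<in> e. f v)"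
    by (simp add: vdegree_def)
  also have "\<dots> = (\<Sum>e\<in>E. \<Sum>v | v \<in> V \<and> v \<in> e. f v)"
    using fin by (rule sum.swap_restrict)
  also have "\<dots> = (\<Sum>e\<in>E. \<Sum>v\<in>e. f v)"
    using assms by (intro sum.cong) (auto simp: simple_graph_def)
  finally show ?thesis .
qed

lemma sum_vdegree:
  assumes "simple_graph V E"
  shows "(\<Sum>v\<in>V. real (vdegree E v)) = 2 * real (card E)"
proof -
  have "(\<Sum>v\<in>V. real (vdegree E v)) = (\<Sum>e\<in>E. real (card e))"
    using sum_vdegree_mult[OF assms, of "\<lambda>_. 1"] by simp
  also have "\<dots> = (\<Sum>e\<in>E. 2)"
    using assms by (intro sum.cong) (auto simp: simple_graph_def)
  finally show ?thesis
    by simp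
qed

text \<open>Expand the square around the mean degree \<open>c\<close>; the cross term is evaluated
  by the handshake lemma.\<close>

lemma sigma_index_tree:
  assumes "is_tree V E"
  shows "sigma_index V E + 4 * (real (card E))\<^sup>2 / real (card V) = (\<Sum>v\<in>V. (real (vdegree E v))\<^sup>2)"
proof -
  have graph: "simple_graph V E"
    using assms by (simp add: is_tree_def)
  define n m where "n = real (card V)" and "m = real (card E)"
  have nm: "n = m + 1" "n > 0"
    using tree_card_vertices[OF assms] by (auto simp: n_def m_def)
  define c where "c = 2 * (n - 1) / n"
  have "sigma_index V E = (\<Sum>v\<in>V. (real (vdegree E v))\<^sup>2 - 2 * c * real (vdegree E v) + c\<^sup>2)"
    unfolding sigma_index_def c_def[unfolded n_def, symmetric]
    by (simp add: power2_diff algebra_simps)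
  also have "\<dots> = (\<Sum>v\<in>V. (real (vdegree E v))\<^sup>2) - 2 * c * (2 * m) + n * c\<^sup>2"
    by (simp add: sum.distrib sum_subtractf sum_vdegree[OF graph] flip: sum_distrib_left n_def m_def)
  finally have "sigma_index V E = (\<Sum>v\<in>V. (real (vdegree E v))\<^sup>2) - 2 * c * (2 * m) + n * c\<^sup>2" .
  \<comment> \<open>Everything follows from \<open>c * n = 2 * m\<close>, which is where
    \<open>m = n - 1\<close> enters: the cross term is twice the constant term.\<close>
  moreover have "2 * c * (2 * m) - n * c\<^sup>2 = 4 * m\<^sup>2 / n"
  proof -
    have "c * n = 2 * m"
      using nm by (simp add: c_def)
    then have "n * c\<^sup>2 = 2 * m * c"
      by (simp add: power2_eq_square ac_simps)
    moreover have "2 * m * c = 4 * m\<^sup>2 / n"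
      using nm(1) by (simp add: c_def power2_eq_square)
    moreover have "2 * c * (2 * m) = 2 * (2 * m * c)"
      by simp
    ultimately show ?thesis
      by linarith
  qed
  ultimately show ?thesis
    by (simp add: n_def m_def)
qed

lemma sum_le_sqrt2_mult_sqrt: "a + b \<le> sqrt 2 * sqrt (a\<^sup>2 + b\<^sup>2)"
  for a b :: real
proof -
  have "2 * (a\<^sup>2 + b\<^sup>2) - (a + b)\<^sup>2 = (a - b)\<^sup>2"
    by (simp add: power2_eq_square algebra_simps)
  then have "(a + b)\<^sup>2 \<le> 2 * (a\<^sup>2 + b\<^sup>2)"
    using zero_le_power2[of "a - b"] by linarith
  then have "a + b \<le> sqrt (2 * (a\<^sup>2 + b\<^sup>2))"
    by (rule real_le_rsqrt)
  then show ?thesis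
    by (simp only: real_sqrt_mult)
qed

theorem theorem3p8:
  fixes V :: "'a set" and E :: "'a set set" and n m :: nat
  assumes "is_tree V E"
    and "card V = n"
    and "card E = m"
  shows "1 / sqrt 2 * (sigma_index V E + 4 * (real m)\<^sup>2 / real n) \<le> sombor_index E
    \<and> sombor_index E \<le> sigma_index V E + 4 * (real m)\<^sup>2 / real n"
proof -
  let ?d = "\<lambda>v. real (vdegree E v)"
  have graph: "simple_graph V E"
    using assms(1) by (simp add: is_tree_def)
  have total: "sigma_index V E + 4 * (real m)\<^sup>2 / real n = (\<Sum>e\<in>E. \<Sum>v\<in>e. ?d v)"
    using sigma_index_tree[OF assms(1)] sum_vdegree_mult[OF graph, of ?d] assms(2,3)
    by (simp add: power2_eq_square)
  have edge: "(\<Sum>v\<in>e. ?d v) \<le> sqrt 2 * sqrt (\<Sum>v\<in>e. (?d v)\<^sup>2)"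
    "sqrt (\<Sum>v\<in>e. (?d v)\<^sup>2) \<le> (\<Sum>v\<in>e. ?d v)" if "e \<in> E" for e
  proof -
    have "card e = 2"
      using graph that by (simp add: simple_graph_def)
    then obtain a b where "e = {a, b}" "a \<noteq> b"
      by (auto simp: card_2_iff)
    then show "(\<Sum>v\<in>e. ?d v) \<le> sqrt 2 * sqrt (\<Sum>v\<in>e. (?d v)\<^sup>2)"
      "sqrt (\<Sum>v\<in>e. (?d v)\<^sup>2) \<le> (\<Sum>v\<in>e. ?d v)"
      \<comment> \<open>The upper bound relies on degrees being nonnegative.\<close>
      using sum_le_sqrt2_mult_sqrt sqrt_sum_squares_le_sum by auto
  qed
  have "(\<Sum>e\<in>E. \<Sum>v\<in>e. ?d v) \<le> sqrt 2 * sombor_index E"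
    unfolding sombor_index_def sum_distrib_left by (rule sum_mono) (rule edge)
  moreover have "sombor_index E \<le> (\<Sum>e\<in>E. \<Sum>v\<in>e. ?d v)"
    unfolding sombor_index_def by (rule sum_mono) (rule edge)
  ultimately show ?thesis
    unfolding total by (simp add: field_simps)
qed

end
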